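(* Let $0<c<1$. For every $m\ge0$, $u\in P_mX_c$ and $z\in(I-P_m)X_c$, $$\|u+z\|_{X_c}^2\le\|u\|_{X_c}^2+\|z\|_{X_c}^2.$$
   Context: All Banach spaces are real. Definition of $X_c$. A norm $N$ on $\mathbb R^2$ is absolute if $N(s,t)=N(|s|,|t|)$ and normalized if $N(1,0)=N(0,1)=1$. Given a sequence $(N_n)_{n\ge1}$ of absolute normalized norms on $\mathbb R^2$, define norms $M_n$ on $\mathbb R^{n+1}$ by $M_0(x_0)=|x_0|$ and $M_n(x_0,\dots,x_n)=N_n(M_{n-1}(x_0,\dots,x_{n-1}),|x_n|)$ for $n\ge1$. For a finitely supported real sequence $x=(x_j)_{j\ge0}\in c_{00}$ put $\|x\|=M_n(x_0,\dots,x_n)$ for any $n$ with $x_j=0$ for all $j>n$ (this is independent of $n$). $A(N_n)$ denotes the completion of $c_{00}$ in this norm, with canonical basis $(e_j)_{j\ge0}$. For $0<c<1$ and $n\ge1$ let $$N_{n,c}(s,t)=\left[(1-c^{2n})|t|^{2n}+(s^2+c^2t^2)^n\right]^{1/(2n)},$$ which is an absolute normalized norm on $\mathbb R^2$, and set $X_c:=A(N_{n,c})$. The canonical basis $(e_j)_{j\ge0}$ of $X_c$ is a ($1$-unconditional) Schauder basis; $P_m$ denotes the canonical projection of $X_c$ onto $\operatorname{span}\{e_0,\dots,e_m\}$, i.e. $P_m\bigl(\sum_{j\ge0}x_je_j\bigr)=\sum_{j=0}^m x_je_j$, and $I$ is the identity. *)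

theory Defs
  imports "HOL-Analysis.Analysis"
begin

definition absolute_normalized_norm :: "(real \<Rightarrow> real \<Rightarrow> real) \<Rightarrow> bool" where
  "absolute_normalized_norm N \<longleftrightarrow>
     (\<forall>s t. 0 \<le> N s t) \<and>
     (\<forall>s t. N s t = 0 \<longleftrightarrow> s = 0 \<and> t = 0) \<and>
     (\<forall>a s t. N (a * s) (a * t) = \<bar>a\<bar> * N s t) \<and>
     (\<forall>s t s' t'. N (s + s') (t + t') \<le> N s t + N s' t') \<and>
     (\<forall>s t. N s t = N \<bar>s\<bar> \<bar>t\<bar>) \<and>
     N 1 0 = 1 \<and> N 0 1 = 1"

text \<open>Only the entries \<open>x 0, \<dots>, x n\<close> are used in \<open>iter_norm N n x\<close>, and the value
  \<open>N 0\<close> is never used.\<close>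

primrec iter_norm :: "(nat \<Rightarrow> real \<Rightarrow> real \<Rightarrow> real) \<Rightarrow> nat \<Rightarrow> (nat \<Rightarrow> real) \<Rightarrow> real" where
  "iter_norm N 0 x = \<bar>x 0\<bar>"
| "iter_norm N (Suc n) x = N (Suc n) (iter_norm N n x) \<bar>x (Suc n)\<bar>"

definition c00 :: "(nat \<Rightarrow> real) set" where
  "c00 = {x. finite {j. x j \<noteq> 0}}"

definition c00_norm :: "(nat \<Rightarrow> real \<Rightarrow> real \<Rightarrow> real) \<Rightarrow> (nat \<Rightarrow> real) \<Rightarrow> real" where
  "c00_norm N x = iter_norm N (LEAST n. \<forall>j>n. x j = 0) x"

lemma iter_norm_nonneg:
  assumes "\<And>n. n \<ge> 1 \<Longrightarrow> absolute_normalized_norm (N n)"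
  shows "0 \<le> iter_norm N n x"
proof (cases n)
  case (Suc k)
  have "absolute_normalized_norm (N (Suc k))" by (rule assms) simp
  then have "0 \<le> N (Suc k) s t" for s t unfolding absolute_normalized_norm_def by blast
  then show ?thesis by (simp add: Suc)
qed simp

text \<open>The index chosen in \<open>c00_norm\<close> is immaterial.\<close>

lemma c00_norm_eq_iter_norm:
  assumes N: "\<And>n. n \<ge> 1 \<Longrightarrow> absolute_normalized_norm (N n)"
    and n: "\<forall>j>n. x j = 0"
  shows "c00_norm N x = iter_norm N n x"
proof -
  define k where "k = (LEAST n. \<forall>j>n. x j = 0)"
  have k: "\<forall>j>k. x j = 0" unfolding k_def by (rule LeastI[of _ n]) (rule n)
  have "k \<le> n" unfolding k_def by (rule Least_le) (rule n)
  then have "iter_norm N n x = iter_norm N k x"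
  proof (induction n rule: dec_induct)
    case (step m)
    have a: "absolute_normalized_norm (N (Suc m))" by (rule N) simp
    have "N (Suc m) (r * 1) (r * 0) = r * N (Suc m) 1 0" if "r \<ge> 0" for r
      using a that unfolding absolute_normalized_norm_def by (metis abs_of_nonneg)
    moreover have "N (Suc m) 1 0 = 1" using a unfolding absolute_normalized_norm_def by blast
    moreover have "0 \<le> iter_norm N m x" by (rule iter_norm_nonneg) (rule N)
    ultimately show ?case using step k by simp
  qed simp
  then show ?thesis by (simp add: c00_norm_def k_def)
qed

text \<open>\<open>X\<close>, with the norm of the ambient space, is a Banach space which is a completion of
  \<open>c00\<close> with the norm \<open>c00_norm N\<close>, the linear isometric embedding being \<open>J\<close>.  Since the
  completion is determined only up to isometric isomorphism, and since a type cannot depend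
  on \<open>N\<close>, the space is given as a subset of a normed space together with \<open>J\<close>.\<close>

definition is_A :: "(nat \<Rightarrow> real \<Rightarrow> real \<Rightarrow> real) \<Rightarrow> ((nat \<Rightarrow> real) \<Rightarrow> 'a::real_normed_vector)
    \<Rightarrow> 'a set \<Rightarrow> bool" where
  "is_A N J X \<longleftrightarrow>
     subspace X \<and> complete X \<and>
     J ` c00 \<subseteq> X \<and> X \<subseteq> closure (J ` c00) \<and>
     (\<forall>x\<in>c00. \<forall>y\<in>c00. J (\<lambda>j. x j + y j) = J x + J y) \<and>
     (\<forall>a. \<forall>x\<in>c00. J (\<lambda>j. a * x j) = a *\<^sub>R J x) \<and>
     (\<forall>x\<in>c00. norm (J x) = c00_norm N x)"

definition canonical_basis :: "((nat \<Rightarrow> real) \<Rightarrow> 'a) \<Rightarrow> nat \<Rightarrow> 'a" where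
  "canonical_basis J j = J (\<lambda>i. if i = j then 1 else 0)"

text \<open>Meaningful for \<open>v\<close> having exactly one expansion in \<open>e\<close>; for the canonical basis this is every
  \<open>v \<in> X\<close>, the basis being a Schauder basis of \<open>X\<close>.\<close>

definition basis_coeff :: "(nat \<Rightarrow> 'a::real_normed_vector) \<Rightarrow> 'a \<Rightarrow> nat \<Rightarrow> real" where
  "basis_coeff e v = (THE a. (\<lambda>j. a j *\<^sub>R e j) sums v)"

definition canonical_proj :: "((nat \<Rightarrow> real) \<Rightarrow> 'a::real_normed_vector) \<Rightarrow> nat \<Rightarrow> 'a \<Rightarrow> 'a" where
  "canonical_proj J m v =
     (\<Sum>j\<le>m. basis_coeff (canonical_basis J) v j *\<^sub>R canonical_basis J j)"

definition N_c :: "real \<Rightarrow> nat \<Rightarrow> real \<Rightarrow> real \<Rightarrow> real" where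
  "N_c c n s t = root (2 * n) ((1 - c ^ (2 * n)) * \<bar>t\<bar> ^ (2 * n) + (s\<^sup>2 + c\<^sup>2 * t\<^sup>2) ^ n)"

lemma power_convex_real:
  fixes x y a b :: real
  assumes "0 \<le> x" "0 \<le> y" "0 \<le> a" "0 \<le> b" "a + b = 1"
  shows "(a * x + b * y) ^ n \<le> a * x ^ n + b * y ^ n"
proof (induction n)
  case (Suc n)
  have "(x - y) * (x ^ n - y ^ n) \<ge> 0"
    using assms(1,2) power_mono[of x y n] power_mono[of y x n]
    by (cases "x \<le> y") (auto intro: mult_nonneg_nonneg mult_nonpos_nonpos)
  then have "a * b * ((x - y) * (x ^ n - y ^ n)) \<ge> 0" using assms by simp
  moreover have "a * x ^ Suc n + b * y ^ Suc n - (a * x + b * y) * (a * x ^ n + b * y ^ n)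
      = a * b * ((x - y) * (x ^ n - y ^ n))"
  proof -
    have b: "b = 1 - a" using assms by simp
    show ?thesis unfolding b by (simp add: algebra_simps)
  qed
  moreover have "(a * x + b * y) ^ Suc n \<le> (a * x + b * y) * (a * x ^ n + b * y ^ n)"
    using Suc assms by (simp add: mult_left_mono)
  ultimately show ?case by linarith
qed (use assms in simp)

lemma absolute_normalized_norm_N_c:
  assumes c: "0 < c" "c < 1" and n: "n \<ge> 1"
  shows "absolute_normalized_norm (N_c c n)"
proof -
  define g where "g s t = (1 - c ^ (2 * n)) * \<bar>t\<bar> ^ (2 * n) + (s\<^sup>2 + c\<^sup>2 * t\<^sup>2) ^ n" for s t :: real
  have N: "N_c c n s t = root (2 * n) (g s t)" for s t by (simp add: N_c_def g_def)
  have c1: "c ^ (2 * n) < 1" using c n power_less_one_iff[of c "2 * n"] by simp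
  have g0: "0 \<le> g s t" for s t using c1 by (simp add: g_def)
  have N0: "0 \<le> N_c c n s t" for s t
    using g0 by (simp add: N real_root_ge_zero)
  have Npow: "N_c c n s t ^ (2 * n) = g s t" for s t
    unfolding N using n g0 by (intro real_root_pow_pos2) auto
  have gz: "s = 0 \<and> t = 0" if "g s t = 0" for s t
  proof -
    have "(s\<^sup>2 + c\<^sup>2 * t\<^sup>2) ^ n \<ge> 0" "(1 - c ^ (2 * n)) * \<bar>t\<bar> ^ (2 * n) \<ge> 0" using c1 by auto
    then have "(s\<^sup>2 + c\<^sup>2 * t\<^sup>2) ^ n = 0" using that unfolding g_def by linarith
    then have "s\<^sup>2 + c\<^sup>2 * t\<^sup>2 = 0" by simp
    then show ?thesis using c by (simp add: add_nonneg_eq_0_iff)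
  qed
  have ghom: "g (a * s) (a * t) = \<bar>a\<bar> ^ (2 * n) * g s t" for a s t
  proof -
    have "(a * s)\<^sup>2 + c\<^sup>2 * (a * t)\<^sup>2 = \<bar>a\<bar>\<^sup>2 * (s\<^sup>2 + c\<^sup>2 * t\<^sup>2)"
      by (simp add: power_mult_distrib algebra_simps)
    then have "((a * s)\<^sup>2 + c\<^sup>2 * (a * t)\<^sup>2) ^ n = \<bar>a\<bar> ^ (2 * n) * (s\<^sup>2 + c\<^sup>2 * t\<^sup>2) ^ n"
      by (simp only: power_mult_distrib power_mult)
    moreover have "\<bar>a * t\<bar> ^ (2 * n) = \<bar>a\<bar> ^ (2 * n) * \<bar>t\<bar> ^ (2 * n)"
      by (simp only: abs_mult power_mult_distrib)
    ultimately show ?thesis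
      unfolding g_def by (simp only: distrib_left mult.left_commute)
  qed
  have hom: "N_c c n (a * s) (a * t) = \<bar>a\<bar> * N_c c n s t" for a s t
    using n by (simp add: N ghom real_root_mult real_root_power_cancel)
  have conv: "g (a * s + b * s') (a * t + b * t') \<le> a * g s t + b * g s' t'"
    if ab: "0 \<le> a" "0 \<le> b" "a + b = 1" for a b s t s' t' :: real
  proof -
    have "\<bar>a * t + b * t'\<bar> \<le> a * \<bar>t\<bar> + b * \<bar>t'\<bar>"
      using ab abs_triangle_ineq[of "a * t" "b * t'"] by (simp add: abs_mult)
    then have "\<bar>a * t + b * t'\<bar> ^ (2 * n) \<le> (a * \<bar>t\<bar> + b * \<bar>t'\<bar>) ^ (2 * n)"
      by (intro power_mono) auto
    also have "\<dots> \<le> a * \<bar>t\<bar> ^ (2 * n) + b * \<bar>t'\<bar> ^ (2 * n)"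
      using ab by (intro power_convex_real) auto
    finally have 1: "(1 - c ^ (2 * n)) * \<bar>a * t + b * t'\<bar> ^ (2 * n)
        \<le> (1 - c ^ (2 * n)) * (a * \<bar>t\<bar> ^ (2 * n) + b * \<bar>t'\<bar> ^ (2 * n))"
      using c1 by (intro mult_left_mono) auto
    have sq: "(a * x + b * y)\<^sup>2 \<le> a * x\<^sup>2 + b * y\<^sup>2" for x y :: real
    proof -
      have b: "b = 1 - a" using ab by simp
      have "a * x\<^sup>2 + b * y\<^sup>2 - (a * x + b * y)\<^sup>2 = a * b * (x - y)\<^sup>2"
        unfolding b by (simp add: algebra_simps power2_eq_square)
      moreover have "a * b * (x - y)\<^sup>2 \<ge> 0" using ab by simp
      ultimately show ?thesis by linarith
    qed
    have "(a * s + b * s')\<^sup>2 + c\<^sup>2 * (a * t + b * t')\<^sup>2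
        \<le> (a * s\<^sup>2 + b * s'\<^sup>2) + c\<^sup>2 * (a * t\<^sup>2 + b * t'\<^sup>2)"
      by (intro add_mono mult_left_mono sq) auto
    then have "((a * s + b * s')\<^sup>2 + c\<^sup>2 * (a * t + b * t')\<^sup>2) ^ n
        \<le> ((a * s\<^sup>2 + b * s'\<^sup>2) + c\<^sup>2 * (a * t\<^sup>2 + b * t'\<^sup>2)) ^ n"
      by (intro power_mono) auto
    also have "\<dots> = (a * (s\<^sup>2 + c\<^sup>2 * t\<^sup>2) + b * (s'\<^sup>2 + c\<^sup>2 * t'\<^sup>2)) ^ n"
      by (simp add: algebra_simps)
    also have "\<dots> \<le> a * (s\<^sup>2 + c\<^sup>2 * t\<^sup>2) ^ n + b * (s'\<^sup>2 + c\<^sup>2 * t'\<^sup>2) ^ n"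
      using ab by (intro power_convex_real) auto
    finally show ?thesis using 1 unfolding g_def by (simp add: algebra_simps)
  qed
  have tri: "N_c c n (s + s') (t + t') \<le> N_c c n s t + N_c c n s' t'" for s t s' t'
  proof -
    define p q where "p = N_c c n s t" and "q = N_c c n s' t'"
    have pq: "0 \<le> p" "0 \<le> q" using N0 by (auto simp: p_def q_def)
    show ?thesis
    proof (cases "p = 0 \<or> q = 0")
      case True
      then show ?thesis
      proof
        assume "p = 0"
        then have "g s t = 0" using n by (simp flip: Npow add: p_def)
        then have "s = 0" "t = 0" using gz[of s t] by simp_all
        then show ?thesis using N0[of 0 0] by simp
      next
        assume "q = 0"
        then have "g s' t' = 0" using n by (simp flip: Npow add: q_def)
        then have "s' = 0" "t' = 0" using gz[of s' t'] by simp_all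
        then show ?thesis using N0[of 0 0] by simp
      qed
    next
      case False
      with pq have pos: "0 < p" "0 < q" by auto
      have gp: "g s t = p ^ (2 * n)" "g s' t' = q ^ (2 * n)"
        by (simp_all only: p_def q_def Npow)
      have unit: "g (s / p) (t / p) = 1" "g (s' / q) (t' / q) = 1"
        using ghom[of "1 / p" s t] ghom[of "1 / q" s' t'] pos
        by (simp_all add: gp power_divide)
      have "g ((1 / (p + q)) * (s + s')) ((1 / (p + q)) * (t + t'))
          = g (p / (p + q) * (s / p) + q / (p + q) * (s' / q))
              (p / (p + q) * (t / p) + q / (p + q) * (t' / q))"
        using pos by (simp add: add_divide_distrib)
      also have "\<dots> \<le> p / (p + q) * 1 + q / (p + q) * 1"
        using conv[of "p / (p + q)" "q / (p + q)" "s / p" "s' / q" "t / p" "t' / q"] pos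
        unfolding unit by (simp add: add_divide_distrib[symmetric])
      also have "\<dots> = 1" using pos by (simp add: add_divide_distrib[symmetric])
      finally have "N_c c n ((1 / (p + q)) * (s + s')) ((1 / (p + q)) * (t + t')) \<le> 1"
        using n unfolding N by (simp add: real_root_le_1_iff)
      then have "(1 / (p + q)) * N_c c n (s + s') (t + t') \<le> 1"
        unfolding hom using pos by simp
      then show ?thesis using pos by (simp add: p_def[symmetric] q_def[symmetric] divide_simps)
    qed
  qed
  have zero: "N_c c n s t = 0 \<longleftrightarrow> s = 0 \<and> t = 0" for s t
    using gz[of s t] n by (cases "s = 0 \<and> t = 0") (auto simp: N g_def power_0_left)
  have abs: "N_c c n s t = N_c c n \<bar>s\<bar> \<bar>t\<bar>" for s t by (simp add: N_c_def)
  have "N_c c n 1 0 = 1"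
    using n by (simp add: N_c_def)
  moreover have "N_c c n 0 1 = 1"
    using n by (simp add: N_c_def power_mult)
  ultimately show ?thesis
    unfolding absolute_normalized_norm_def
    by (intro conjI allI) (rule N0 zero hom tri abs | assumption)+
qed

end

theory Submission
  imports Defs
begin

text \<open>
  The square of \<open>N_c c n\<close>, as a function of the square of its first argument, is
  \<open>S \<mapsto> (K + (S + c\<^sup>2t\<^sup>2)\<^sup>n)\<^bsup>1/n\<^esup>\<close> with \<open>K \<ge> 0\<close>, and this function is 1-Lipschitz:
  increasing \<open>S\<close> by \<open>A\<close> increases it by at most \<open>A\<close>.  Taking \<open>A\<close> to be the squared norm of the
  head \<open>u\<close>, an estimate \<open>\<parallel>u + z\<parallel>\<^sup>2 \<le> \<parallel>u\<parallel>\<^sup>2 + \<parallel>z\<parallel>\<^sup>2\<close> for the truncations at the index \<open>n\<close>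
  therefore passes to those at \<open>n + 1\<close>, where \<open>u + z\<close> and \<open>z\<close> have the same new entry.
  It starts with equality at \<open>n = m\<close>, where \<open>z\<close> is still zero.  This is
  \<open>iter_norm_N_c_split\<close>, the inequality on finitely supported sequences.

  The passage to the completion needs that the canonical basis is a Schauder basis of \<open>A(N)\<close>.  This
  holds for all absolute normalized norms, because coordinates and truncations are contractions
  on \<open>c00\<close>: a vector that is a limit of finitely supported sequences then has limit coordinates, and
  their truncations converge to it (\<open>expansion_exists\<close>).  The vector \<open>u\<close> is itself finitely
  supported, and \<open>z\<close> is the limit of finitely supported sequences vanishing up to \<open>m\<close>, so the
  inequality survives in the limit.
\<close>

section \<open>The inequality for finitely supported sequences\<close>

text \<open>The left-hand side is \<open>\<integral> n s\<^bsup>n-1\<^esup> ds\<close> over \<open>[v, a + v]\<close>, and the integrand increases.\<close>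

lemma power_increment_mono:
  fixes a v b :: real
  assumes "0 \<le> a" "0 \<le> v" "v \<le> b"
  shows "(a + v) ^ n - v ^ n \<le> (a + b) ^ n - b ^ n"
proof (induction n)
  case (Suc n)
  have split: "(a + x) ^ Suc n - x ^ Suc n = (a + x) * ((a + x) ^ n - x ^ n) + a * x ^ n" for x
    by (simp add: algebra_simps)
  have "0 \<le> (a + v) ^ n - v ^ n"
    using assms by (simp add: power_mono)
  then have "(a + v) * ((a + v) ^ n - v ^ n) \<le> (a + b) * ((a + b) ^ n - b ^ n)"
    using assms Suc by (intro mult_mono) auto
  moreover have "a * v ^ n \<le> a * b ^ n"
    using assms by (intro mult_left_mono power_mono) auto
  ultimately show ?case unfolding split by linarith
qed simp

lemma N_c_square_power:
  assumes "0 < c" "c < 1" "n \<ge> 1"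
  shows "((N_c c n s t)\<^sup>2) ^ n = (1 - c ^ (2 * n)) * \<bar>t\<bar> ^ (2 * n) + (s\<^sup>2 + c\<^sup>2 * t\<^sup>2) ^ n"
proof -
  have "c ^ (2 * n) \<le> 1" using assms by (simp add: power_le_one)
  then show ?thesis
    using assms unfolding N_c_def power_mult[symmetric]
    by (intro real_root_pow_pos2) auto
qed

text \<open>In terms of squares this is the 1-Lipschitz property of \<open>N_c c n\<close> in its first argument,
  combined with monotonicity.  It follows from \<open>power_increment_mono\<close> with
  \<open>v = w\<^sup>2 + c\<^sup>2t\<^sup>2\<close>, whose \<open>n\<close>-th power is at most that of \<open>b = (N_c c n w t)\<^sup>2\<close>.\<close>

lemma N_c_square_le:
  assumes c: "0 < c" "c < 1" and n: "n \<ge> 1" and r: "r\<^sup>2 \<le> a\<^sup>2 + w\<^sup>2"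
  shows "(N_c c n r t)\<^sup>2 \<le> a\<^sup>2 + (N_c c n w t)\<^sup>2"
proof -
  define K where "K = (1 - c ^ (2 * n)) * \<bar>t\<bar> ^ (2 * n)"
  define v where "v = w\<^sup>2 + c\<^sup>2 * t\<^sup>2"
  define b where "b = (N_c c n w t)\<^sup>2"
  have K: "0 \<le> K" using c by (simp add: K_def power_le_one)
  have bn: "b ^ n = K + v ^ n"
    unfolding b_def K_def v_def by (rule N_c_square_power[OF c n])
  have "v ^ n \<le> b ^ n" using K bn by simp
  then have vb: "v \<le> b"
    using n by (simp add: b_def power_mono_iff v_def)
  have "((N_c c n r t)\<^sup>2) ^ n = K + (r\<^sup>2 + c\<^sup>2 * t\<^sup>2) ^ n"
    unfolding K_def by (rule N_c_square_power[OF c n])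
  also have "\<dots> \<le> K + (a\<^sup>2 + v) ^ n"
    using r by (intro add_left_mono power_mono) (auto simp: v_def)
  also have "\<dots> \<le> (a\<^sup>2 + b) ^ n"
    using power_increment_mono[of "a\<^sup>2" v b n] vb bn by (simp add: v_def)
  finally show ?thesis
    using n power_mono_iff[of "(N_c c n r t)\<^sup>2" "a\<^sup>2 + b" n] by (simp add: b_def)
qed

lemma iter_norm_cong:
  "(\<And>j. j \<le> n \<Longrightarrow> x j = y j) \<Longrightarrow> iter_norm N n x = iter_norm N n y"
  by (induction n) auto

lemma iter_norm_N_c_split:
  assumes c: "0 < c" "c < 1" and "m \<le> n"
    and x: "\<forall>j>m. x j = 0" and y: "\<forall>j\<le>m. y j = 0"
  shows "(iter_norm (N_c c) n (\<lambda>j. x j + y j))\<^sup>2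
    \<le> (iter_norm (N_c c) m x)\<^sup>2 + (iter_norm (N_c c) n y)\<^sup>2"
  using \<open>m \<le> n\<close>
proof (induction n rule: dec_induct)
  case base
  have "iter_norm (N_c c) m (\<lambda>j. x j + y j) = iter_norm (N_c c) m x"
    by (rule iter_norm_cong) (simp add: y)
  then show ?case by simp
next
  case (step n)
  then have "x (Suc n) = 0" using x by simp
  then show ?case
    using N_c_square_le[OF c _ step.IH] by simp
qed

section \<open>The canonical basis is a Schauder basis\<close>

definition trunc :: "nat \<Rightarrow> (nat \<Rightarrow> real) \<Rightarrow> nat \<Rightarrow> real" where
  "trunc n x = (\<lambda>j. if j \<le> n then x j else 0)"

text \<open>An absolute norm dominates its arguments because \<open>(s, 0)\<close> and \<open>(0, t)\<close> are averages of
  \<open>(s, t)\<close> with a vector of the same norm, \<open>(s, -t)\<close> or \<open>(-s, t)\<close>.\<close>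

lemma absolute_normalized_norm_ge:
  assumes "absolute_normalized_norm N"
  shows "\<bar>s\<bar> \<le> N s t" and "\<bar>t\<bar> \<le> N s t"
proof -
  have tri: "N (a + a') (b + b') \<le> N a b + N a' b'"
    and hom: "N (r * a) (r * b) = \<bar>r\<bar> * N a b"
    and abs: "N a b = N \<bar>a\<bar> \<bar>b\<bar>" and one: "N 1 0 = 1" "N 0 1 = 1" for a a' b b' r
    using assms unfolding absolute_normalized_norm_def by blast+
  have "N s (- t) = N s t" "N (- s) t = N s t"
    using abs[of s "- t"] abs[of "- s" t] abs[of s t] by simp_all
  then show "\<bar>s\<bar> \<le> N s t" "\<bar>t\<bar> \<le> N s t"
    using tri[of s s t "- t"] tri[of s "- s" t t] hom[of "2 * s" 1 0] hom[of "2 * t" 0 1] one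
    by (simp_all add: abs_mult)
qed

lemma c00I: "\<forall>j>n. x j = 0 \<Longrightarrow> x \<in> c00"
  unfolding c00_def mem_Collect_eq
  by (rule finite_subset[of _ "{..n}"]) (auto intro: leI)

lemma c00E:
  assumes "x \<in> c00" obtains n where "\<forall>j>n. x j = 0"
proof -
  have "finite {j. x j \<noteq> 0}" using assms by (simp add: c00_def)
  then obtain n where "\<forall>j\<in>{j. x j \<noteq> 0}. j \<le> n"
    using finite_nat_set_iff_bounded_le by blast
  then show ?thesis using that[of n] by force
qed

lemma trunc_c00: "trunc n x \<in> c00"
  by (rule c00I[of n]) (simp add: trunc_def)

lemma add_c00:
  assumes "x \<in> c00" "y \<in> c00" shows "(\<lambda>j. x j + y j) \<in> c00"
proof -
  have "{j. x j + y j \<noteq> 0} \<subseteq> {j. x j \<noteq> 0} \<union> {j. y j \<noteq> 0}" by auto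
  then show ?thesis using assms finite_subset unfolding c00_def by fastforce
qed

lemma scale_c00: "x \<in> c00 \<Longrightarrow> (\<lambda>j. a * x j) \<in> c00" for a :: real
  unfolding c00_def by (auto elim: rev_finite_subset)

lemma unit_c00: "(\<lambda>i. if i = j then 1 else 0) \<in> c00"
  by (rule c00I[of j]) simp

locale A_space =
  fixes N :: "nat \<Rightarrow> real \<Rightarrow> real \<Rightarrow> real"
    and J :: "(nat \<Rightarrow> real) \<Rightarrow> 'a::real_normed_vector" and X :: "'a set"
  assumes norms: "n \<ge> 1 \<Longrightarrow> absolute_normalized_norm (N n)"
    and is_A: "is_A N J X"
begin

abbreviation e :: "nat \<Rightarrow> 'a" where
  "e \<equiv> canonical_basis J"

lemma J_add: "x \<in> c00 \<Longrightarrow> y \<in> c00 \<Longrightarrow> J (\<lambda>j. x j + y j) = J x + J y"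
  and J_scale: "x \<in> c00 \<Longrightarrow> J (\<lambda>j. a * x j) = a *\<^sub>R J x"
  and norm_J: "x \<in> c00 \<Longrightarrow> norm (J x) = c00_norm N x"
  and X_subset_closure: "X \<subseteq> closure (J ` c00)"
  using is_A unfolding is_A_def by blast+

lemma diff_c00: "x \<in> c00 \<Longrightarrow> y \<in> c00 \<Longrightarrow> (\<lambda>j. x j - y j) \<in> c00"
  using add_c00[of x "\<lambda>j. -1 * y j"] scale_c00[of y "-1"] by simp

lemma J_diff:
  assumes "x \<in> c00" "y \<in> c00" shows "J (\<lambda>j. x j - y j) = J x - J y"
  using assms J_add[of x "\<lambda>j. -1 * y j"] scale_c00[of y "-1"] J_scale[of y "-1"] by simp

lemma norm_J_iter_norm: "\<forall>j>n. x j = 0 \<Longrightarrow> norm (J x) = iter_norm N n x"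
  by (simp add: norm_J[OF c00I] c00_norm_eq_iter_norm[OF norms])

lemma iter_norm_mono: "k \<le> n \<Longrightarrow> iter_norm N k x \<le> iter_norm N n x"
proof (induction n rule: dec_induct)
  case (step n)
  have "\<bar>iter_norm N n x\<bar> \<le> iter_norm N (Suc n) x"
    using absolute_normalized_norm_ge(1)[OF norms[of "Suc n"]] by simp
  then show ?case using step.IH by linarith
qed simp

lemma abs_le_iter_norm: "\<bar>x k\<bar> \<le> iter_norm N k x"
proof (cases k)
  case (Suc i)
  have "\<bar>\<bar>x k\<bar>\<bar> \<le> N (Suc i) (iter_norm N i x) \<bar>x k\<bar>"
    by (rule absolute_normalized_norm_ge(2)[OF norms]) simp
  then show ?thesis by (simp add: Suc)
qed simp

lemma norm_J_trunc: "norm (J (trunc k x)) = iter_norm N k x"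
proof -
  have "norm (J (trunc k x)) = iter_norm N k (trunc k x)"
    by (rule norm_J_iter_norm) (simp add: trunc_def)
  also have "\<dots> = iter_norm N k x"
    by (rule iter_norm_cong) (simp add: trunc_def)
  finally show ?thesis .
qed

lemma iter_norm_le_norm_J:
  assumes "x \<in> c00" shows "iter_norm N k x \<le> norm (J x)"
proof -
  obtain n where n: "\<forall>j>n. x j = 0" using c00E[OF assms] .
  then have "norm (J x) = iter_norm N (max k n) x"
    by (intro norm_J_iter_norm) simp
  then show ?thesis using iter_norm_mono[of k "max k n" x] by simp
qed

lemma trunc_contraction: "x \<in> c00 \<Longrightarrow> norm (J (trunc k x)) \<le> norm (J x)"
  by (simp add: norm_J_trunc iter_norm_le_norm_J)

lemma coordinate_contraction: "x \<in> c00 \<Longrightarrow> \<bar>x k\<bar> \<le> norm (J x)"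
  using abs_le_iter_norm iter_norm_le_norm_J order_trans by blast

lemma J_trunc_eq_sum: "J (trunc n x) = (\<Sum>j\<le>n. x j *\<^sub>R e j)"
proof (induction n)
  case 0
  have "trunc 0 x = (\<lambda>i. x 0 * (if i = 0 then 1 else 0))"
    by (auto simp: trunc_def)
  then show ?case
    by (simp add: canonical_basis_def J_scale[OF unit_c00] del: mult_1_right)
next
  case (Suc n)
  have "trunc (Suc n) x = (\<lambda>i. trunc n x i + x (Suc n) * (if i = Suc n then 1 else 0))"
    by (rule ext) (auto simp: trunc_def le_Suc_eq)
  then have "J (trunc (Suc n) x) = J (trunc n x) + x (Suc n) *\<^sub>R e (Suc n)"
    by (simp only: J_add[OF trunc_c00 scale_c00[OF unit_c00]] J_scale[OF unit_c00]
        canonical_basis_def)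
  then show ?case using Suc by simp
qed

lemma sums_basis_iff: "(\<lambda>j. a j *\<^sub>R e j) sums v \<longleftrightarrow> (\<lambda>n. J (trunc n a)) \<longlonglongrightarrow> v"
  unfolding sums_def_le J_trunc_eq_sum ..

lemma expansion_unique:
  assumes "(\<lambda>j. a j *\<^sub>R e j) sums v" "(\<lambda>j. b j *\<^sub>R e j) sums v"
  shows "a = b"
proof
  fix k
  define d where "d = (\<lambda>j. a j - b j)"
  have "(\<lambda>j. d j *\<^sub>R e j) sums 0"
    using sums_diff[OF assms] by (simp add: d_def scaleR_diff_left)
  then have "(\<lambda>n. norm (J (trunc n d))) \<longlonglongrightarrow> 0"
    unfolding sums_basis_iff by (rule tendsto_norm_zero)
  moreover have "\<bar>d k\<bar> \<le> norm (J (trunc n d))" if "k \<le> n" for n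
    using coordinate_contraction[OF trunc_c00, of n d k] that by (simp add: trunc_def)
  ultimately have "\<bar>d k\<bar> \<le> 0"
    by (intro LIMSEQ_le_const) auto
  then show "a k = b k" by (simp add: d_def)
qed

text \<open>Let \<open>J (x i)\<close> converge to \<open>v\<close>, with \<open>x i\<close> finitely supported.  Since coordinates are contractive, \<open>x i\<close> converges
  coordinatewise to some \<open>a\<close>.  Since truncations are contractive, the \<open>n\<close>-th truncations of \<open>a\<close>
  and of \<open>x i\<close> are no farther apart than \<open>v\<close> and \<open>J (x i)\<close>, uniformly in \<open>n\<close>; and for large \<open>n\<close> the
  truncation of \<open>x i\<close> is \<open>x i\<close>.\<close>

lemma expansion_exists:
  assumes "v \<in> X" obtains a where "(\<lambda>j. a j *\<^sub>R e j) sums v"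
proof -
  have "v \<in> closure (J ` c00)" using X_subset_closure assms by auto
  then obtain w where w: "\<And>i. w i \<in> J ` c00" and wlim: "w \<longlonglongrightarrow> v"
    unfolding closure_sequential by blast
  from w obtain x where x: "\<And>i. x i \<in> c00" and wx: "\<And>i. w i = J (x i)"
    unfolding image_iff by metis
  have lim: "(\<lambda>i. J (x i)) \<longlonglongrightarrow> v" using wlim by (simp flip: wx)
  have "convergent (\<lambda>i. x i k)" for k
  proof (rule real_Cauchy_convergent, rule CauchyI)
    fix \<epsilon> :: real assume "0 < \<epsilon>"
    then obtain M where M: "\<And>i l. i \<ge> M \<Longrightarrow> l \<ge> M \<Longrightarrow> norm (J (x i) - J (x l)) < \<epsilon>"
      using LIMSEQ_imp_Cauchy[OF lim] CauchyD by blast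
    have "\<bar>x i k - x l k\<bar> \<le> norm (J (x i) - J (x l))" for i l
      using coordinate_contraction[OF diff_c00[OF x x], of i k l] J_diff[OF x x] by simp
    then show "\<exists>M. \<forall>i\<ge>M. \<forall>l\<ge>M. norm (x i k - x l k) < \<epsilon>"
      using M by (metis le_less_trans real_norm_def)
  qed
  then obtain a where a: "\<And>k. (\<lambda>i. x i k) \<longlonglongrightarrow> a k"
    unfolding convergent_def by metis
  have trunc_lim: "(\<lambda>l. J (trunc n (x l))) \<longlonglongrightarrow> J (trunc n a)" for n
    unfolding J_trunc_eq_sum by (intro tendsto_intros a)
  have unif: "norm (J (trunc n (x i)) - J (trunc n a)) \<le> norm (J (x i) - v)" for n i
  proof (rule LIMSEQ_le)
    show "(\<lambda>l. norm (J (trunc n (x i)) - J (trunc n (x l))))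
        \<longlonglongrightarrow> norm (J (trunc n (x i)) - J (trunc n a))"
      by (intro tendsto_intros trunc_lim)
    show "(\<lambda>l. norm (J (x i) - J (x l))) \<longlonglongrightarrow> norm (J (x i) - v)"
      by (intro tendsto_intros lim)
    have "norm (J (trunc n (x i)) - J (trunc n (x l))) \<le> norm (J (x i) - J (x l))" for l
    proof -
      have "trunc n (\<lambda>j. x i j - x l j) = (\<lambda>j. trunc n (x i) j - trunc n (x l) j)"
        by (auto simp: trunc_def)
      then show ?thesis
        using trunc_contraction[OF diff_c00[OF x x], of n i l]
        by (simp add: J_diff x trunc_c00)
    qed
    then show "\<exists>M. \<forall>l\<ge>M. norm (J (trunc n (x i)) - J (trunc n (x l)))
        \<le> norm (J (x i) - J (x l))" by blast
  qed
  have "(\<lambda>n. J (trunc n a)) \<longlonglongrightarrow> v"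
  proof (rule LIMSEQ_I)
    fix \<epsilon> :: real assume "0 < \<epsilon>"
    then obtain i where i: "norm (J (x i) - v) < \<epsilon> / 2"
      using LIMSEQ_D[OF lim, of "\<epsilon> / 2"] by auto
    obtain M where M: "\<forall>j>M. x i j = 0" using c00E[OF x] .
    have "norm (J (trunc n a) - v) < \<epsilon>" if "n \<ge> M" for n
    proof -
      have "trunc n (x i) = x i" using M that by (auto simp: trunc_def)
      then have "norm (J (x i) - J (trunc n a)) \<le> norm (J (x i) - v)"
        using unif[of n i] by simp
      then show ?thesis
        using i norm_triangle_ineq[of "J (trunc n a) - J (x i)" "J (x i) - v"]
        by (simp add: norm_minus_commute)
    qed
    then show "\<exists>M. \<forall>n\<ge>M. norm (J (trunc n a) - v) < \<epsilon>" by blast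
  qed
  then show ?thesis using that sums_basis_iff by blast
qed

lemma sums_basis_coeff:
  assumes "v \<in> X" shows "(\<lambda>j. basis_coeff e v j *\<^sub>R e j) sums v"
proof -
  obtain a where a: "(\<lambda>j. a j *\<^sub>R e j) sums v" using expansion_exists[OF assms] .
  show ?thesis
    unfolding basis_coeff_def
    by (rule theI[where P = "\<lambda>a. (\<lambda>j. a j *\<^sub>R e j) sums v", OF a])
      (rule expansion_unique[OF _ a])
qed

lemma canonical_proj_eq: "canonical_proj J m v = J (trunc m (basis_coeff e v))"
  by (simp add: canonical_proj_def J_trunc_eq_sum)

end

section \<open>Passage to the completion\<close>

theorem proposition3p4:
  fixes c :: real and m :: nat
    and J :: "(nat \<Rightarrow> real) \<Rightarrow> 'a::real_normed_vector" and X :: "'a set"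
    and u z :: 'a
  assumes "0 < c" and "c < 1"
    and "is_A (N_c c) J X"
    and "u \<in> canonical_proj J m ` X"
    and "z \<in> (\<lambda>v. v - canonical_proj J m v) ` X"
  shows "(norm (u + z))\<^sup>2 \<le> (norm u)\<^sup>2 + (norm z)\<^sup>2"
proof -
  interpret A_space "N_c c" J X
    using assms absolute_normalized_norm_N_c by unfold_locales auto
  obtain a where u: "u = J (trunc m a)"
    using assms(4) canonical_proj_eq by auto
  obtain v where "v \<in> X" and z: "z = v - canonical_proj J m v"
    using assms(5) by auto
  define b where "b = basis_coeff e v"
  have "(\<lambda>n. J (trunc n b)) \<longlonglongrightarrow> v"
    using sums_basis_coeff[OF \<open>v \<in> X\<close>] by (simp add: sums_basis_iff b_def)
  then have lim: "(\<lambda>n. J (trunc n b) - J (trunc m b)) \<longlonglongrightarrow> z"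
    unfolding z canonical_proj_eq b_def[symmetric] by (intro tendsto_intros)
  have fin: "(norm (u + (J (trunc n b) - J (trunc m b))))\<^sup>2
      \<le> (norm u)\<^sup>2 + (norm (J (trunc n b) - J (trunc m b)))\<^sup>2" if "m \<le> n" for n
  proof -
    define y where "y = (\<lambda>j. trunc n b j - trunc m b j)"
    have x0: "\<forall>j>m. trunc m a j = 0" by (simp add: trunc_def)
    have y0: "\<forall>j>n. y j = 0" "\<forall>j\<le>m. y j = 0" using that by (auto simp: y_def trunc_def)
    have Jy: "J y = J (trunc n b) - J (trunc m b)"
      unfolding y_def by (intro J_diff trunc_c00)
    have sum: "J (\<lambda>j. trunc m a j + y j) = u + J y"
      unfolding u using c00I[OF y0(1)] by (intro J_add trunc_c00)
    have "norm (u + J y) = iter_norm (N_c c) n (\<lambda>j. trunc m a j + y j)"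
      unfolding sum[symmetric] using x0 y0 that by (intro norm_J_iter_norm) auto
    moreover have "norm u = iter_norm (N_c c) m (trunc m a)"
      unfolding u by (rule norm_J_iter_norm[OF x0])
    moreover have "norm (J y) = iter_norm (N_c c) n y"
      by (rule norm_J_iter_norm[OF y0(1)])
    ultimately show ?thesis
      using iter_norm_N_c_split[OF assms(1,2) that x0 y0(2)] by (simp add: Jy)
  qed
  show ?thesis
  proof (rule LIMSEQ_le)
    show "(\<lambda>n. (norm (u + (J (trunc n b) - J (trunc m b))))\<^sup>2) \<longlonglongrightarrow> (norm (u + z))\<^sup>2"
      by (intro tendsto_intros lim)
    show "(\<lambda>n. (norm u)\<^sup>2 + (norm (J (trunc n b) - J (trunc m b)))\<^sup>2)
        \<longlonglongrightarrow> (norm u)\<^sup>2 + (norm z)\<^sup>2"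
      by (intro tendsto_intros lim)
  qed (use fin in blast)
qed

end
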